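(* Let $k\ge 2$. For $f\in\mathcal H_k$, the following are equivalent: \begin{enumerate} \item $f\in\mathcal W_{k-1}^{\perp}$, i.e. $\int f w\,d\pi_k=0$ for every $w\in\mathcal W_{k-1}$; \item $\mathsf E_L f=0$ and $\mathsf E_R f=0$ (in $L^2$); \item for $\pi_{k-1}$-a.e. $(x_1,\dots,x_{k-1})$ and for $\pi_{k-1}$-a.e. $(x_2,\dots,x_k)$, respectively, \[ \int f(x_1,\dots,x_{k-1},x_k)\,\nu(dx_k)=0,\qquad \int f(x_1,x_2,\dots,x_k)\,\nu(dx_1)=0 . \] \end{enumerate}
   Context: Let $(\mathcal X,\mathcal F,\nu)$ be a probability space, $\pi_k=\nu^{\otimes k}$, and let $\mathcal H_k$ be the Hilbert space of functions $f\in L^2(\mathcal X^k,\pi_k)$ with $\int f\,d\pi_k=0$. Define \[ (\mathsf E_L f)(x_1,\dots,x_{k-1})=\int f(x_1,\dots,x_k)\,\nu(dx_k),\qquad (\mathsf E_R f)(x_2,\dots,x_k)=\int f(x_1,\dots,x_k)\,\nu(dx_1), \] and \[ \mathcal W_{k-1}=\{u(x_1,\dots,x_{k-1})+v(x_2,\dots,x_k):\ u,v\in L^2(\mathcal X^{k-1},\pi_{k-1})\}. \] *)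

theory Defs
  imports "HOL-Probability.Probability"
begin

definition L2 :: "'b measure \<Rightarrow> ('b \<Rightarrow> real) set" where
  "L2 M = {f \<in> borel_measurable M. integrable M (\<lambda>x. (f x)\<^sup>2)}"

text \<open>Elements of the Hilbert space are represented by functions; equality of the elements
  represented by two functions is this relation, which includes membership of both.\<close>

definition L2_eq :: "'b measure \<Rightarrow> (('b \<Rightarrow> real) \<times> ('b \<Rightarrow> real)) set" where
  "L2_eq M = {(f, g). f \<in> L2 M \<and> g \<in> L2 M \<and> (AE x in M. f x = g x)}"

lemma equiv_L2_eq: "equiv (L2 M) (L2_eq M)"
proof (rule equivI)
  show "trans (L2_eq M)"
    by (rule transI) (auto simp: L2_eq_def elim: AE_mp)
qed (auto simp: L2_eq_def refl_on_def sym_def eq_commute)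

definition L2_orth :: "'b measure \<Rightarrow> ('b \<Rightarrow> real) set \<Rightarrow> ('b \<Rightarrow> real) set" where
  "L2_orth M W = {f \<in> L2 M. \<forall>w\<in>W. (\<integral>x. f x * w x \<partial>M) = 0}"

text \<open>A point \<open>(x\<^sub>1, \<dots>, x\<^sub>k)\<close> is an extensional function on the indices \<open>{1..k}\<close>.\<close>

definition prod_pow :: "'a measure \<Rightarrow> nat \<Rightarrow> (nat \<Rightarrow> 'a) measure" where
  "prod_pow \<nu> k = (\<Pi>\<^sub>M i\<in>{1..k}. \<nu>)"

text \<open>For a point \<open>y\<close> with \<open>k - 1\<close> coordinates, these are \<open>(y\<^sub>1, \<dots>, y\<^sub>k\<^sub>-\<^sub>1, t)\<close> and
  \<open>(t, y\<^sub>1, \<dots>, y\<^sub>k\<^sub>-\<^sub>1)\<close>.\<close>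

definition append_last :: "nat \<Rightarrow> (nat \<Rightarrow> 'a) \<Rightarrow> 'a \<Rightarrow> (nat \<Rightarrow> 'a)" where
  "append_last k y t = (\<lambda>i\<in>{1..k}. if i = k then t else y i)"

definition append_first :: "nat \<Rightarrow> 'a \<Rightarrow> (nat \<Rightarrow> 'a) \<Rightarrow> (nat \<Rightarrow> 'a)" where
  "append_first k t y = (\<lambda>i\<in>{1..k}. if i = 1 then t else y (i - 1))"

text \<open>For a point \<open>x\<close> with \<open>k\<close> coordinates, these are \<open>(x\<^sub>1, \<dots>, x\<^sub>k\<^sub>-\<^sub>1)\<close> and
  \<open>(x\<^sub>2, \<dots>, x\<^sub>k)\<close>, the latter re-indexed by \<open>{1..k - 1}\<close>.\<close>

definition drop_last :: "nat \<Rightarrow> (nat \<Rightarrow> 'a) \<Rightarrow> (nat \<Rightarrow> 'a)" where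
  "drop_last k x = (\<lambda>i\<in>{1..k - 1}. x i)"

definition drop_first :: "nat \<Rightarrow> (nat \<Rightarrow> 'a) \<Rightarrow> (nat \<Rightarrow> 'a)" where
  "drop_first k x = (\<lambda>i\<in>{1..k - 1}. x (i + 1))"

definition H :: "'a measure \<Rightarrow> nat \<Rightarrow> ((nat \<Rightarrow> 'a) \<Rightarrow> real) set" where
  "H \<nu> k = {f \<in> L2 (prod_pow \<nu> k). (\<integral>x. f x \<partial>prod_pow \<nu> k) = 0}"

definition E_L :: "'a measure \<Rightarrow> nat \<Rightarrow> ((nat \<Rightarrow> 'a) \<Rightarrow> real) \<Rightarrow> ((nat \<Rightarrow> 'a) \<Rightarrow> real)" where
  "E_L \<nu> k f = (\<lambda>y. \<integral>t. f (append_last k y t) \<partial>\<nu>)"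

definition E_R :: "'a measure \<Rightarrow> nat \<Rightarrow> ((nat \<Rightarrow> 'a) \<Rightarrow> real) \<Rightarrow> ((nat \<Rightarrow> 'a) \<Rightarrow> real)" where
  "E_R \<nu> k f = (\<lambda>y. \<integral>t. f (append_first k t y) \<partial>\<nu>)"

text \<open>The index is the number of coordinates of the full point: \<open>W \<nu> k\<close> is
  \<open>\<W>\<^sub>k\<^sub>-\<^sub>1\<close>, a set of functions of \<open>k\<close> coordinates.\<close>

definition W :: "'a measure \<Rightarrow> nat \<Rightarrow> ((nat \<Rightarrow> 'a) \<Rightarrow> real) set" where
  "W \<nu> k = {\<lambda>x. u (drop_last k x) + v (drop_first k x) | u v.
     u \<in> L2 (prod_pow \<nu> (k - 1)) \<and> v \<in> L2 (prod_pow \<nu> (k - 1))}"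

end

theory Submission
  imports Defs
begin

section \<open>Square-integrable functions\<close>

lemma L2_measurable [measurable_dest]: "f \<in> L2 M \<Longrightarrow> f \<in> borel_measurable M"
  by (simp add: L2_def)

lemma L2_integrable_square: "f \<in> L2 M \<Longrightarrow> integrable M (\<lambda>x. (f x)\<^sup>2)"
  by (simp add: L2_def)

lemma zero_in_L2 [simp]: "(\<lambda>_. 0) \<in> L2 M"
  by (simp add: L2_def)

lemma L2_eq_zero_iff: "f \<in> L2 M \<Longrightarrow> (f, \<lambda>_. 0) \<in> L2_eq M \<longleftrightarrow> (AE x in M. f x = 0)"
  by (simp add: L2_eq_def)

text \<open>The sum of the two squares dominates the product. This makes the pairings below honest
  integrals, to which Fubini and additivity apply.\<close>

lemma L2_integrable_mult:
  assumes f: "f \<in> L2 M" and g: "g \<in> L2 M"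
  shows "integrable M (\<lambda>x. f x * g x)"
proof (rule Bochner_Integration.integrable_bound)
  show "integrable M (\<lambda>x. (f x)\<^sup>2 + (g x)\<^sup>2)"
    by (intro Bochner_Integration.integrable_add L2_integrable_square f g)
  show "(\<lambda>x. f x * g x) \<in> borel_measurable M"
    using f g by measurable
  have "\<bar>a * b\<bar> \<le> a\<^sup>2 + b\<^sup>2" for a b :: real
  proof -
    have "2 * \<bar>a * b\<bar> \<le> a\<^sup>2 + b\<^sup>2"
      using sum_squares_bound[of "\<bar>a\<bar>" "\<bar>b\<bar>"] by (simp add: abs_mult)
    then show ?thesis by linarith
  qed
  then show "AE x in M. norm (f x * g x) \<le> norm ((f x)\<^sup>2 + (g x)\<^sup>2)"
    by simp
qed

text \<open>On a probability space the constant 1 is square-integrable, and \<open>f\<close> is its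
  product with 1.\<close>

lemma (in prob_space) L2_integrable:
  assumes "f \<in> L2 M"
  shows "integrable M f"
proof -
  have "(\<lambda>_. 1) \<in> L2 M" by (simp add: L2_def)
  from L2_integrable_mult[OF assms this] show ?thesis by simp
qed

text \<open>Jensen's inequality for the square, read off from the nonnegativity of the
  variance.\<close>

lemma (in prob_space) square_expectation_le:
  fixes f :: "'a \<Rightarrow> real"
  assumes "f \<in> L2 M"
  shows "(expectation f)\<^sup>2 \<le> expectation (\<lambda>x. (f x)\<^sup>2)"
  using variance_positive[of f]
    variance_eq[OF L2_integrable[OF assms] L2_integrable_square[OF assms]]
  by linarith

text \<open>Change of variables along a measure-preserving map.\<close>

lemma L2_comp_distr:
  assumes "\<phi> \<in> measurable M N" and "distr M N \<phi> = N" and "f \<in> L2 N"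
  shows "(\<lambda>x. f (\<phi> x)) \<in> L2 M"
proof -
  have "integrable (distr M N \<phi>) (\<lambda>x. (f x)\<^sup>2)"
    using assms by (simp add: L2_integrable_square)
  then have "integrable M (\<lambda>x. (f (\<phi> x))\<^sup>2)"
    using assms(1) by (rule integrable_distr[rotated])
  then show ?thesis
    using measurable_compose[OF assms(1) L2_measurable[OF assms(3)]] by (simp add: L2_def)
qed

section \<open>Fibre means in a split probability space\<close>

text \<open>A probability space \<open>P\<close> that splits as \<open>A \<Otimes> B\<close> via \<open>\<phi>\<close>, with \<open>\<pi>\<close> recovering the
  \<open>A\<close>-coordinate; \<open>fibre_mean\<close> is conditional expectation given \<open>\<pi>\<close>, hence the adjoint of
  \<open>u \<mapsto> u \<circ> \<pi>\<close>.\<close>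

locale prob_splitting = A: prob_space A + B: prob_space B
  for A :: "'a measure" and B :: "'b measure" +
  fixes P :: "'c measure" and \<phi> :: "'a \<Rightarrow> 'b \<Rightarrow> 'c" and \<pi> :: "'c \<Rightarrow> 'a"
  assumes split_measurable: "case_prod \<phi> \<in> measurable (A \<Otimes>\<^sub>M B) P"
    and distr_split: "distr (A \<Otimes>\<^sub>M B) P (case_prod \<phi>) = P"
    and proj_measurable: "\<pi> \<in> measurable P A"
    and proj_split: "y \<in> space A \<Longrightarrow> \<pi> (\<phi> y t) = y"
begin

sublocale pair_prob_space A B ..

definition fibre_mean :: "('c \<Rightarrow> real) \<Rightarrow> 'a \<Rightarrow> real" where
  "fibre_mean f y = (\<integral>t. f (\<phi> y t) \<partial>B)"

lemma L2_split:
  assumes "f \<in> L2 P"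
  shows "(\<lambda>(y, t). f (\<phi> y t)) \<in> L2 (A \<Otimes>\<^sub>M B)"
  using L2_comp_distr[OF split_measurable distr_split assms] by (simp add: case_prod_beta')

text \<open>Since \<open>B\<close> has total mass 1, the first marginal of the product is
  \<open>A\<close>.\<close>

lemma fst_L2:
  assumes "u \<in> L2 A"
  shows "(\<lambda>p. u (fst p)) \<in> L2 (A \<Otimes>\<^sub>M B)"
proof (rule L2_comp_distr[OF measurable_fst _ assms])
  show "distr (A \<Otimes>\<^sub>M B) A fst = A"
    by (rule B.distr_pair_fst)
qed

text \<open>The locale does not assume that \<open>\<pi>\<close> carries \<open>P\<close> to
  \<open>A\<close>. Integrability is therefore checked on \<open>A \<Otimes>\<^sub>M B\<close>,
  where \<open>\<pi>\<close> becomes \<open>fst\<close>.\<close>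

lemma proj_L2:
  assumes u: "u \<in> L2 A"
  shows "(\<lambda>x. u (\<pi> x)) \<in> L2 P"
proof -
  note [measurable] = proj_measurable split_measurable
  have [measurable]: "u \<in> borel_measurable A" using u by measurable
  have "integrable (A \<Otimes>\<^sub>M B) (\<lambda>p. (u (\<pi> (case_prod \<phi> p)))\<^sup>2)
      \<longleftrightarrow> integrable (A \<Otimes>\<^sub>M B) (\<lambda>p. (u (fst p))\<^sup>2)"
    \<comment> \<open>\<open>proj_split\<close> holds only for \<open>y\<close> in
      \<open>space A\<close>, hence a congruence over the space.\<close>
    by (intro Bochner_Integration.integrable_cong)
       (auto simp: space_pair_measure proj_split)
  then have "integrable (A \<Otimes>\<^sub>M B) (\<lambda>p. (u (\<pi> (case_prod \<phi> p)))\<^sup>2)"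
    using L2_integrable_square[OF fst_L2[OF u]] by simp
  then have "integrable (distr (A \<Otimes>\<^sub>M B) P (case_prod \<phi>)) (\<lambda>x. (u (\<pi> x))\<^sup>2)"
    by (subst integrable_distr_eq) auto
  then show ?thesis
    by (simp add: L2_def distr_split)
qed

text \<open>Conditional expectation contracts the L2 norm: Jensen on the fibres, then Fubini for the
  fibrewise second moments.\<close>

lemma fibre_mean_L2:
  assumes f: "f \<in> L2 P"
  shows "fibre_mean f \<in> L2 A"
proof -
  let ?g = "\<lambda>y t. f (\<phi> y t)"
  have g: "case_prod ?g \<in> L2 (A \<Otimes>\<^sub>M B)" by (rule L2_split[OF f])
  then have g_meas [measurable]: "case_prod ?g \<in> borel_measurable (A \<Otimes>\<^sub>M B)"
    by measurable
  have sq: "integrable (A \<Otimes>\<^sub>M B) (\<lambda>(y, t). (?g y t)\<^sup>2)"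
    using L2_integrable_square[OF g] by (simp add: case_prod_beta')
  have meas: "fibre_mean f \<in> borel_measurable A"
    unfolding fibre_mean_def by measurable
  \<comment> \<open>Fubini makes the squared section integrable only for almost every
    \<open>y\<close>. \<open>AE_space\<close> adds \<open>y \<in> space A\<close>, from which the
    section is measurable.\<close>
  have "AE y in A. (fibre_mean f y)\<^sup>2 \<le> (\<integral>t. (?g y t)\<^sup>2 \<partial>B)"
    using AE_integrable_fst'[OF sq] AE_space
  proof eventually_elim
    case (elim y)
    then have "?g y \<in> L2 B"
      using measurable_Pair2[OF g_meas] by (simp add: L2_def)
    then show ?case
      unfolding fibre_mean_def by (rule B.square_expectation_le)
  qed
  then have "integrable A (\<lambda>y. (fibre_mean f y)\<^sup>2)"
    using meas by (intro Bochner_Integration.integrable_bound[OF integrable_fst'[OF sq]]) auto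
  with meas show ?thesis by (simp add: L2_def)
qed

text \<open>The adjoint relation: after transport to the product, the factor from \<open>u\<close>
  is constant along each fibre and leaves the inner integral.\<close>

lemma integral_mult_proj:
  assumes f: "f \<in> L2 P" and u: "u \<in> L2 A"
  shows "(\<integral>x. f x * u (\<pi> x) \<partial>P) = (\<integral>y. fibre_mean f y * u y \<partial>A)"
proof -
  note [measurable] = proj_measurable split_measurable
  have [measurable]: "f \<in> borel_measurable P" "u \<in> borel_measurable A"
    using f u by measurable
  have int: "integrable (A \<Otimes>\<^sub>M B) (\<lambda>(y, t). f (\<phi> y t) * u y)"
    using L2_integrable_mult[OF L2_split[OF f] fst_L2[OF u]] by (simp add: case_prod_beta')
  have "(\<integral>x. f x * u (\<pi> x) \<partial>P) = (\<integral>x. f x * u (\<pi> x) \<partial>distr (A \<Otimes>\<^sub>M B) P (case_prod \<phi>))"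
    by (simp add: distr_split)
  also have "\<dots> = (\<integral>p. f (case_prod \<phi> p) * u (\<pi> (case_prod \<phi> p)) \<partial>(A \<Otimes>\<^sub>M B))"
    by (rule integral_distr) measurable
  also have "\<dots> = (\<integral>(y, t). f (\<phi> y t) * u y \<partial>(A \<Otimes>\<^sub>M B))"
    by (intro Bochner_Integration.integral_cong) (auto simp: space_pair_measure proj_split)
  also have "\<dots> = (\<integral>y. \<integral>t. f (\<phi> y t) * u y \<partial>B \<partial>A)"
    using integral_fst'[OF int] by simp
  \<comment> \<open>Pulling out \<open>u y\<close> is valid for every \<open>y\<close>: if the
    section is not integrable, both sides are 0 by the convention for the Bochner integral.\<close>
  finally show ?thesis
    by (simp add: fibre_mean_def)
qed

text \<open>The orthogonal complement of the range of an operator is the kernel of its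
  adjoint.\<close>

lemma orth_proj_iff:
  assumes f: "f \<in> L2 P"
  shows "(\<forall>u\<in>L2 A. (\<integral>x. f x * u (\<pi> x) \<partial>P) = 0) \<longleftrightarrow> (AE y in A. fibre_mean f y = 0)"
proof
  assume "\<forall>u\<in>L2 A. (\<integral>x. f x * u (\<pi> x) \<partial>P) = 0"
  \<comment> \<open>The test function is \<open>u = fibre_mean f\<close> itself, so that the pairing
    becomes its squared norm.\<close>
  then have "(\<integral>y. (fibre_mean f y)\<^sup>2 \<partial>A) = 0"
    using fibre_mean_L2[OF f] by (simp add: integral_mult_proj[OF f] power2_eq_square)
  then show "AE y in A. fibre_mean f y = 0"
    using integral_nonneg_eq_0_iff_AE[OF L2_integrable_square[OF fibre_mean_L2[OF f]]] by simp
next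
  assume *: "AE y in A. fibre_mean f y = 0"
  show "\<forall>u\<in>L2 A. (\<integral>x. f x * u (\<pi> x) \<partial>P) = 0"
  proof
    fix u assume "u \<in> L2 A"
    then show "(\<integral>x. f x * u (\<pi> x) \<partial>P) = 0"
      using * by (simp add: integral_mult_proj[OF f])
        (intro integral_eq_zero_AE, auto)
  qed
qed

end

section \<open>Product powers and their coordinate maps\<close>

lemma space_prod_pow: "space (prod_pow \<nu> k) = (\<Pi>\<^sub>E i\<in>{1..k}. space \<nu>)"
  by (simp add: prod_pow_def space_PiM)

lemma prod_pow_extensional: "y \<in> space (prod_pow \<nu> k) \<Longrightarrow> y \<in> extensional {1..k}"
  by (auto simp: space_prod_pow PiE_iff)

lemma prob_space_prod_pow:
  assumes "prob_space \<nu>"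
  shows "prob_space (prod_pow \<nu> k)"
  unfolding prod_pow_def using assms by (intro prob_space_PiM)

text \<open>Measurable boxes generate the product sigma-algebra and are closed under intersection,
  so they determine the measure.\<close>

lemma prod_pow_eqI:
  assumes "prob_space \<nu>" and "sets M = sets (prod_pow \<nu> k)"
    and "\<And>A. (\<And>i. i \<in> {1..k} \<Longrightarrow> A i \<in> sets \<nu>) \<Longrightarrow>
      emeasure M (Pi\<^sub>E {1..k} A) = (\<Prod>i=1..k. emeasure \<nu> (A i))"
  shows "M = prod_pow \<nu> k"
proof -
  interpret prob_space \<nu> by fact
  interpret product_sigma_finite "\<lambda>_::nat. \<nu>" ..
  show ?thesis
    unfolding prod_pow_def using assms by (intro PiM_eqI) (auto simp: prod_pow_def)
qed

lemma emeasure_prod_pow: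
  assumes "prob_space \<nu>" and "\<And>i. i \<in> {1..k} \<Longrightarrow> A i \<in> sets \<nu>"
  shows "emeasure (prod_pow \<nu> k) (Pi\<^sub>E {1..k} A) = (\<Prod>i=1..k. emeasure \<nu> (A i))"
proof -
  interpret prob_space \<nu> by fact
  interpret product_sigma_finite "\<lambda>_::nat. \<nu>" ..
  show ?thesis
    unfolding prod_pow_def using assms by (intro emeasure_PiM) auto
qed

lemma measurable_append_last:
  assumes "k \<ge> 1"
  shows "(\<lambda>(y, t). append_last k y t) \<in> measurable (prod_pow \<nu> (k - 1) \<Otimes>\<^sub>M \<nu>) (prod_pow \<nu> k)"
  unfolding prod_pow_def append_last_def case_prod_beta'
proof (rule measurable_restrict)
  fix i assume "i \<in> {1..k}"
  then show "(\<lambda>p. if i = k then snd p else fst p i)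
      \<in> measurable ((\<Pi>\<^sub>M i\<in>{1..k - 1}. \<nu>) \<Otimes>\<^sub>M \<nu>) \<nu>"
    by (cases "i = k") auto
qed

lemma measurable_append_first:
  assumes "k \<ge> 1"
  shows "(\<lambda>(y, t). append_first k t y) \<in> measurable (prod_pow \<nu> (k - 1) \<Otimes>\<^sub>M \<nu>) (prod_pow \<nu> k)"
  unfolding prod_pow_def append_first_def case_prod_beta'
proof (rule measurable_restrict)
  fix i assume "i \<in> {1..k}"
  then show "(\<lambda>p. if i = 1 then snd p else fst p (i - 1))
      \<in> measurable ((\<Pi>\<^sub>M i\<in>{1..k - 1}. \<nu>) \<Otimes>\<^sub>M \<nu>) \<nu>"
    by (cases "i = 1")
      (auto intro!: measurable_compose[OF measurable_fst measurable_component_singleton])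
qed

lemma measurable_drop_last: "drop_last k \<in> measurable (prod_pow \<nu> k) (prod_pow \<nu> (k - 1))"
  unfolding prod_pow_def drop_last_def by (rule measurable_restrict) auto

lemma measurable_drop_first: "drop_first k \<in> measurable (prod_pow \<nu> k) (prod_pow \<nu> (k - 1))"
  unfolding prod_pow_def drop_first_def by (rule measurable_restrict) auto

section \<open>Laws of the appending maps\<close>

text \<open>Appending ignores the values of \<open>y\<close> outside \<open>{1..k - 1}\<close>, so
  extensionality of \<open>y\<close>, which the right side demands, has to be assumed.\<close>

lemma append_last_in_PiE_iff:
  assumes "k \<ge> 1" and "y \<in> extensional {1..k - 1}"
  shows "append_last k y t \<in> Pi\<^sub>E {1..k} A \<longleftrightarrow> y \<in> Pi\<^sub>E {1..k - 1} A \<and> t \<in> A k"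
proof -
  have "{1..k} = insert k {1..k - 1}" using assms(1) by auto
  then show ?thesis
    using assms by (auto simp: append_last_def PiE_iff)
qed

lemma append_first_in_PiE_iff:
  assumes "k \<ge> 1" and "y \<in> extensional {1..k - 1}"
  shows "append_first k t y \<in> Pi\<^sub>E {1..k} A \<longleftrightarrow> y \<in> Pi\<^sub>E {1..k - 1} (\<lambda>i. A (Suc i)) \<and> t \<in> A 1"
proof -
  \<comment> \<open>Every index but 1 is a successor; this turns the shift of coordinates into a
    shift of the sides of the box.\<close>
  have "{1..k} = insert 1 (Suc ` {1..k - 1})"
    using assms(1) by (auto simp: image_Suc_atLeastAtMost)
  then have "(\<forall>i\<in>{1..k}. append_first k t y i \<in> A i) \<longleftrightarrow>
      append_first k t y 1 \<in> A 1 \<and> (\<forall>i\<in>{1..k - 1}. append_first k t y (Suc i) \<in> A (Suc i))"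
    by (simp only:) blast
  also have "\<dots> \<longleftrightarrow> t \<in> A 1 \<and> (\<forall>i\<in>{1..k - 1}. y i \<in> A (Suc i))"
    using assms(1) by (auto simp: append_first_def)
  finally show ?thesis
    using assms(2) by (auto simp: PiE_iff append_first_def)
qed

text \<open>The preimage of a box is a box times its last side, so both measures give it the same
  product of side masses.\<close>

lemma distr_append_last:
  assumes \<nu>: "prob_space \<nu>" and k: "k \<ge> 1"
  shows "distr (prod_pow \<nu> (k - 1) \<Otimes>\<^sub>M \<nu>) (prod_pow \<nu> k) (\<lambda>(y, t). append_last k y t) = prod_pow \<nu> k"
    (is "distr ?M _ ?\<phi> = _")
proof (rule prod_pow_eqI[OF \<nu>])
  interpret \<nu>: prob_space \<nu> by fact
  fix A assume A: "\<And>i. i \<in> {1..k} \<Longrightarrow> A i \<in> sets \<nu>"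
  have A': "A i \<in> sets \<nu>" if "i \<in> {1..k - 1}" for i
    using that by (intro A) auto
  have sets: "Pi\<^sub>E {1..k} A \<in> sets (prod_pow \<nu> k)" "Pi\<^sub>E {1..k - 1} A \<in> sets (prod_pow \<nu> (k - 1))"
    unfolding prod_pow_def using A by (auto intro!: sets_PiM_I_finite)
  have "?\<phi> -` Pi\<^sub>E {1..k} A \<inter> space ?M = Pi\<^sub>E {1..k - 1} A \<times> A k"
  proof -
    \<comment> \<open>The sides lie inside the spaces, so intersecting the preimage with
      \<open>space ?M\<close> loses nothing.\<close>
    have "A k \<subseteq> space \<nu>" "Pi\<^sub>E {1..k - 1} A \<subseteq> space (prod_pow \<nu> (k - 1))"
      using A[of k] k sets sets.sets_into_space by auto
    then show ?thesis
      by (auto simp: space_pair_measure append_last_in_PiE_iff[OF k] prod_pow_extensional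
          simp del: One_nat_def del: PiE_I)
  qed
  then have "emeasure (distr ?M (prod_pow \<nu> k) ?\<phi>) (Pi\<^sub>E {1..k} A)
      = emeasure ?M (Pi\<^sub>E {1..k - 1} A \<times> A k)"
    using emeasure_distr[OF measurable_append_last[OF k] sets(1)] by simp
  also have "\<dots> = (\<Prod>i=1..k - 1. emeasure \<nu> (A i)) * emeasure \<nu> (A k)"
    using A k sets emeasure_prod_pow[OF \<nu> A']
    by (subst \<nu>.emeasure_pair_measure_Times) auto
  also have "\<dots> = (\<Prod>i=1..k. emeasure \<nu> (A i))"
    using k by (cases k) auto
  finally show "emeasure (distr ?M (prod_pow \<nu> k) ?\<phi>) (Pi\<^sub>E {1..k} A) = \<dots>" .
qed simp

lemma distr_append_first:
  assumes \<nu>: "prob_space \<nu>" and k: "k \<ge> 1"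
  shows "distr (prod_pow \<nu> (k - 1) \<Otimes>\<^sub>M \<nu>) (prod_pow \<nu> k) (\<lambda>(y, t). append_first k t y) = prod_pow \<nu> k"
    (is "distr ?M _ ?\<phi> = _")
proof (rule prod_pow_eqI[OF \<nu>])
  interpret \<nu>: prob_space \<nu> by fact
  fix A assume A: "\<And>i. i \<in> {1..k} \<Longrightarrow> A i \<in> sets \<nu>"
  let ?A' = "\<lambda>i. A (Suc i)"
  have A': "?A' i \<in> sets \<nu>" if "i \<in> {1..k - 1}" for i
    using that by (intro A) auto
  have sets: "Pi\<^sub>E {1..k} A \<in> sets (prod_pow \<nu> k)" "Pi\<^sub>E {1..k - 1} ?A' \<in> sets (prod_pow \<nu> (k - 1))"
    unfolding prod_pow_def using A by (auto intro!: sets_PiM_I_finite)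
  \<comment> \<open>The new coordinate has index 1 but is the second component of the pair, hence
    \<open>A 1\<close> on the right.\<close>
  have "?\<phi> -` Pi\<^sub>E {1..k} A \<inter> space ?M = Pi\<^sub>E {1..k - 1} ?A' \<times> A 1"
  proof -
    have "A 1 \<subseteq> space \<nu>" "Pi\<^sub>E {1..k - 1} ?A' \<subseteq> space (prod_pow \<nu> (k - 1))"
      using A[of 1] k sets sets.sets_into_space by auto
    then show ?thesis
      by (auto simp: space_pair_measure append_first_in_PiE_iff[OF k] prod_pow_extensional
          simp del: One_nat_def del: PiE_I)
  qed
  then have "emeasure (distr ?M (prod_pow \<nu> k) ?\<phi>) (Pi\<^sub>E {1..k} A)
      = emeasure ?M (Pi\<^sub>E {1..k - 1} ?A' \<times> A 1)"
    using emeasure_distr[OF measurable_append_first[OF k] sets(1)] by simp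
  also have "\<dots> = (\<Prod>i=1..k - 1. emeasure \<nu> (?A' i)) * emeasure \<nu> (A 1)"
    using A k sets emeasure_prod_pow[OF \<nu> A']
    by (subst \<nu>.emeasure_pair_measure_Times) auto
  \<comment> \<open>The factor with index 1 is split off and the remaining indices are shifted down
    by one.\<close>
  also have "\<dots> = (\<Prod>i=1..k. emeasure \<nu> (A i))"
    using k prod.atLeast_Suc_atMost[of 1 k "\<lambda>i. emeasure \<nu> (A i)"]
      prod.shift_bounds_cl_Suc_ivl[of "\<lambda>i. emeasure \<nu> (A i)" 1 "k - 1"]
    by (simp add: mult.commute)
  finally show "emeasure (distr ?M (prod_pow \<nu> k) ?\<phi>) (Pi\<^sub>E {1..k} A) = \<dots>" .
qed simp

section \<open>The two splittings of the product power and the equivalence\<close>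

lemma drop_last_append_last:
  "y \<in> space (prod_pow \<nu> (k - 1)) \<Longrightarrow> drop_last k (append_last k y t) = y"
  \<comment> \<open>Points of the space are extensional, so agreement on \<open>{1..k - 1}\<close>
    suffices for equality.\<close>
  by (rule extensionalityI[of _ "{1..k - 1}"])
    (auto simp: drop_last_def append_last_def space_prod_pow PiE_iff)

lemma drop_first_append_first:
  "y \<in> space (prod_pow \<nu> (k - 1)) \<Longrightarrow> drop_first k (append_first k t y) = y"
  by (rule extensionalityI[of _ "{1..k - 1}"])
    (auto simp: drop_first_def append_first_def space_prod_pow PiE_iff)

lemma prob_splitting_last:
  assumes "prob_space \<nu>" and "k \<ge> 1"
  shows "prob_splitting (prod_pow \<nu> (k - 1)) \<nu> (prod_pow \<nu> k) (append_last k) (drop_last k)"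
  using assms
  by (intro prob_splitting.intro prob_splitting_axioms.intro prob_space_prod_pow
      measurable_append_last distr_append_last measurable_drop_last drop_last_append_last)

lemma prob_splitting_first:
  assumes "prob_space \<nu>" and "k \<ge> 1"
  shows "prob_splitting (prod_pow \<nu> (k - 1)) \<nu> (prod_pow \<nu> k) (\<lambda>y t. append_first k t y) (drop_first k)"
  using assms
  by (intro prob_splitting.intro prob_splitting_axioms.intro prob_space_prod_pow
      measurable_append_first distr_append_first measurable_drop_first drop_first_append_first)

theorem proposition3p6:
  fixes \<nu> :: "'a measure" and k :: nat and f :: "(nat \<Rightarrow> 'a) \<Rightarrow> real"
  assumes "prob_space \<nu>" and "k \<ge> 2" and "f \<in> H \<nu> k"
  shows
    "(f \<in> L2_orth (prod_pow \<nu> k) (W \<nu> k) \<longleftrightarrow>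
        (E_L \<nu> k f, \<lambda>_. 0) \<in> L2_eq (prod_pow \<nu> (k - 1)) \<and>
        (E_R \<nu> k f, \<lambda>_. 0) \<in> L2_eq (prod_pow \<nu> (k - 1))) \<and>
     ((E_L \<nu> k f, \<lambda>_. 0) \<in> L2_eq (prod_pow \<nu> (k - 1)) \<and>
        (E_R \<nu> k f, \<lambda>_. 0) \<in> L2_eq (prod_pow \<nu> (k - 1)) \<longleftrightarrow>
        (AE y in prod_pow \<nu> (k - 1). (\<integral>t. f (append_last k y t) \<partial>\<nu>) = 0) \<and>
        (AE y in prod_pow \<nu> (k - 1). (\<integral>t. f (append_first k t y) \<partial>\<nu>) = 0))"
proof -
  let ?P = "prod_pow \<nu> k" and ?Q = "prod_pow \<nu> (k - 1)"
  have k: "k \<ge> 1" using assms(2) by simp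
  interpret L: prob_splitting ?Q \<nu> ?P "append_last k" "drop_last k"
    by (rule prob_splitting_last[OF assms(1) k])
  interpret R: prob_splitting ?Q \<nu> ?P "\<lambda>y t. append_first k t y" "drop_first k"
    by (rule prob_splitting_first[OF assms(1) k])
  have f: "f \<in> L2 ?P" using assms(3) by (simp add: H_def)
  \<comment> \<open>Both operators are instances of one construction, for the two ways to split off
    a coordinate.\<close>
  have E_L: "E_L \<nu> k f = L.fibre_mean f" and E_R: "E_R \<nu> k f = R.fibre_mean f"
    by (simp_all add: fun_eq_iff E_L_def E_R_def L.fibre_mean_def R.fibre_mean_def)
  \<comment> \<open>Additivity of the integral requires both products to be integrable, which
    \<open>proj_L2\<close> secures.\<close>
  have split: "(\<integral>x. f x * (u (drop_last k x) + v (drop_first k x)) \<partial>?P)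
      = (\<integral>x. f x * u (drop_last k x) \<partial>?P) + (\<integral>x. f x * v (drop_first k x) \<partial>?P)"
    if "u \<in> L2 ?Q" "v \<in> L2 ?Q" for u v
    using L2_integrable_mult[OF f L.proj_L2[OF that(1)]] L2_integrable_mult[OF f R.proj_L2[OF that(2)]]
    by (simp add: distrib_left)
  have "f \<in> L2_orth ?P (W \<nu> k) \<longleftrightarrow>
      (\<forall>u\<in>L2 ?Q. \<forall>v\<in>L2 ?Q. (\<integral>x. f x * (u (drop_last k x) + v (drop_first k x)) \<partial>?P) = 0)"
    using f by (auto simp: L2_orth_def W_def)
  also have "\<dots> \<longleftrightarrow> (\<forall>u\<in>L2 ?Q. (\<integral>x. f x * u (drop_last k x) \<partial>?P) = 0) \<and>
      (\<forall>v\<in>L2 ?Q. (\<integral>x. f x * v (drop_first k x) \<partial>?P) = 0)" (is "?sum \<longleftrightarrow> ?left \<and> ?right")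
  proof
    assume *: ?sum
    \<comment> \<open>Taking \<open>v = 0\<close>, and then \<open>u = 0\<close>, separates the two
      families of conditions.\<close>
    have ?left using * zero_in_L2[of ?Q] by fastforce
    moreover have ?right using * zero_in_L2[of ?Q] by fastforce
    ultimately show "?left \<and> ?right" ..
  qed (simp add: split)
  also have "\<dots> \<longleftrightarrow> (AE y in ?Q. E_L \<nu> k f y = 0) \<and> (AE y in ?Q. E_R \<nu> k f y = 0)"
    by (simp only: L.orth_proj_iff[OF f] R.orth_proj_iff[OF f] E_L E_R)
  finally show ?thesis
    \<comment> \<open>\<open>L2_eq\<close> also demands membership in \<open>L2\<close>, supplied
      here for both fibre means. What remains of (2) is almost everywhere vanishing, which is (3)
      after unfolding.\<close>
    using L.fibre_mean_L2[OF f] R.fibre_mean_L2[OF f]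
    unfolding E_L[symmetric] E_R[symmetric]
    by (simp only: L2_eq_zero_iff) (simp only: E_L_def E_R_def simp_thms)
qed

end
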